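(* Let $d\ge0$ be an integer, $P_d,Q_d$ the Legendre functions of degree $d$ on $(-1,1)$, and $H_d=\sum_{j=1}^d\frac1j$ the harmonic number. Then, for $x\in(-1,1)$, $$\frac{v_0(x)}{P_d(x)}=\operatorname{artanh}x-\frac{Q_d(x)}{P_d(x)}-H_d$$ (away from the zeros of $P_d$).
   Context: $P_d^{(\alpha,\beta)}$ denotes the Jacobi polynomial in the standard (Szegő) normalisation. The function $v_0$ is the first transverse variation at $a=0$ at fixed degree $d$: $$v_0(x)=\partial_\delta\left[\frac{P^{(\delta,-\delta)}_d(x)}{P^{(\delta,-\delta)}_d(1)}\right]_{\delta=0}.$$ $P_d$ is the Legendre polynomial and $Q_d$ the Legendre function of the second kind on the cut $(-1,1)$, e.g. $Q_0(x)=\operatorname{artanh}x$, $Q_1(x)=x\operatorname{artanh}x-1$, normalised by $P_dQ_d'-Q_dP_d'=(1-x^2)^{-1}$. *)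

theory Defs
  imports "HOL-Analysis.Analysis"
begin

text \<open>
  The Jacobi polynomial in Szego's normalisation, for arbitrary real parameters:
  \<open>(\<alpha>+1)\<^sub>n / n! \<cdot> F(-n, n+\<alpha>+\<beta>+1; \<alpha>+1; (1-x)/2)\<close>, where the factor \<open>(\<alpha>+1)\<^sub>n\<close> is cancelled
  termwise against the denominators \<open>(\<alpha>+1)\<^sub>k\<close>, so that no parameter has to be excluded.
\<close>

definition jacobi_P :: "real \<Rightarrow> real \<Rightarrow> nat \<Rightarrow> real \<Rightarrow> real" where
  "jacobi_P \<alpha> \<beta> n x =
     (\<Sum>k\<le>n. pochhammer (real n + \<alpha> + \<beta> + 1) k * pochhammer (\<alpha> + real k + 1) (n - k)
            / (fact k * fact (n - k)) * ((x - 1) / 2) ^ k)"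

definition legendre_P :: "nat \<Rightarrow> real \<Rightarrow> real" where
  "legendre_P n = jacobi_P 0 0 n"

text \<open>
  The Legendre function of the second kind on the cut, generated from \<open>Q\<^sub>0\<close> and \<open>Q\<^sub>1\<close> by the
  three-term recurrence shared by \<open>P\<^sub>n\<close> and \<open>Q\<^sub>n\<close>. It is meaningful for \<open>-1 < x < 1\<close> only.
  The lemmas \<open>legendre_P_ODE\<close>, \<open>legendre_Q_ODE\<close> and \<open>legendre_wronskian\<close> below confirm that
  \<open>P\<^sub>n\<close> and \<open>Q\<^sub>n\<close> solve Legendre's equation with the Wronskian \<open>1/(1-x\<^sup>2)\<close>.
\<close>

fun legendre_Q :: "nat \<Rightarrow> real \<Rightarrow> real" where
  "legendre_Q 0 x = artanh x"
| "legendre_Q (Suc 0) x = x * artanh x - 1"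
| "legendre_Q (Suc (Suc n)) x =
     (real (2 * n + 3) * x * legendre_Q (Suc n) x - real (n + 1) * legendre_Q n x) / real (n + 2)"

definition transverse_v0 :: "nat \<Rightarrow> real \<Rightarrow> real" where
  "transverse_v0 d x = deriv (\<lambda>\<delta>. jacobi_P \<delta> (-\<delta>) d x / jacobi_P \<delta> (-\<delta>) d 1) 0"


lemma jacobi_P_at_1: "jacobi_P \<alpha> \<beta> n 1 = (real n + \<alpha>) gchoose n"
proof -
  have "jacobi_P \<alpha> \<beta> n 1 = (\<Sum>k\<le>n. if k = 0 then pochhammer (\<alpha> + 1) n / fact n else 0)"
    unfolding jacobi_P_def by (intro sum.cong) auto
  then show ?thesis
    by (simp add: gbinomial_pochhammer' add.commute)
qed

text \<open>The quotient defining \<open>v\<^sub>0\<close> is differentiable at \<open>\<delta> = 0\<close>, so \<open>deriv\<close> is the true derivative.\<close>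

lemma transverse_v0_has_derivative:
  "((\<lambda>\<delta>. jacobi_P \<delta> (-\<delta>) d x / jacobi_P \<delta> (-\<delta>) d 1) has_real_derivative transverse_v0 d x) (at 0)"
proof -
  have poch: "(\<lambda>\<delta>. pochhammer (\<delta> + b) k) field_differentiable (at 0)" for b :: real and k
    by (induction k)
      (auto simp: pochhammer_Suc intro!: field_differentiable_mult field_differentiable_add)
  have diff: "(\<lambda>\<delta>. jacobi_P \<delta> (-\<delta>) d y) field_differentiable (at 0)" for y
  proof -
    have "(\<lambda>\<delta>. \<Sum>k\<le>d. pochhammer (real d + 1) k * pochhammer (\<delta> + (real k + 1)) (d - k)
            / (fact k * fact (d - k)) * ((y - 1) / 2) ^ k) field_differentiable (at 0)"
      by (intro field_differentiable_sum field_differentiable_mult field_differentiable_divide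
          field_differentiable_const poch) auto
    then show ?thesis
      by (simp add: jacobi_P_def add.assoc)
  qed
  have "pochhammer (1::real) d \<noteq> 0"
    by (simp add: pochhammer_fact [symmetric])
  then have "jacobi_P 0 0 d 1 \<noteq> 0"
    by (simp add: jacobi_P_at_1 gbinomial_pochhammer')
  then have "(\<lambda>\<delta>. jacobi_P \<delta> (-\<delta>) d x / jacobi_P \<delta> (-\<delta>) d 1) field_differentiable (at 0)"
    by (intro field_differentiable_divide diff) simp
  then show ?thesis
    unfolding transverse_v0_def by (simp add: field_differentiable_derivI)
qed

lemma legendre_P_0: "legendre_P 0 x = 1"
  and legendre_P_1: "legendre_P (Suc 0) x = x"
  by (simp_all add: legendre_P_def jacobi_P_def field_simps)

context
begin

private definition c :: "nat \<Rightarrow> nat \<Rightarrow> real" where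
  "c n k = (if k \<le> n then fact (n + k) / (fact k ^ 2 * fact (n - k)) else 0)"

private lemma legendre_P_sum:
  assumes "n \<le> N"
  shows "legendre_P n x = (\<Sum>k\<le>N. c n k * ((x - 1) / 2) ^ k)"
proof -
  have poch: "pochhammer (real m + 1) k = fact (m + k) / fact m" for m k
    using pochhammer_product' [of "1::real" m k]
    by (simp add: pochhammer_fact [symmetric] field_simps)
  have "legendre_P n x = (\<Sum>k\<le>n. c n k * ((x - 1) / 2) ^ k)"
    unfolding legendre_P_def jacobi_P_def
    by (intro sum.cong) (auto simp: c_def poch power2_eq_square)
  also have "\<dots> = (\<Sum>k\<le>N. c n k * ((x - 1) / 2) ^ k)"
    using assms by (intro sum.mono_neutral_left) (auto simp: c_def)
  finally show ?thesis .
qed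

private lemma c_rec_0: "real (n + 2) * c (Suc (Suc n)) 0 = real (2 * n + 3) * c (Suc n) 0 - real (n + 1) * c n 0"
  by (simp add: c_def)

private lemma c_rec_Suc:
  "real (n + 2) * c (Suc (Suc n)) (Suc j) =
     real (2 * n + 3) * (c (Suc n) (Suc j) + 2 * c (Suc n) j) - real (n + 1) * c n (Suc j)"
proof -
  consider "Suc j \<le> n" | "j = n" | "j = Suc n" | "j > Suc n" by linarith
  then show ?thesis
  proof cases
    case 1
    then obtain m where n: "n = Suc (j + m)"
      by (metis add_Suc le_iff_add)
    define A B C where "A = (fact (2 * j + m) :: real)" and "B = (fact j :: real)" and "C = (fact m :: real)"
    have nz: "A \<noteq> 0" "B \<noteq> 0" "C \<noteq> 0" by (simp_all add: A_def B_def C_def)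
    define J M where "J = real j" and "M = real m"
    have pos: "J \<ge> 0" "M \<ge> 0" by (simp_all add: J_def M_def)
    have f2: "fact (j + (j + m)) = A" "fact (j + m + j) = A"
      unfolding A_def by (rule arg_cong [where f = fact], simp)+
    have e: "c (Suc (Suc n)) (Suc j) = (2*J+M+4)*(2*J+M+3)*(2*J+M+2)*(2*J+M+1)*A / (((J+1)*B)^2*((M+2)*(M+1)*C))"
            "c (Suc n) (Suc j) = (2*J+M+3)*(2*J+M+2)*(2*J+M+1)*A / (((J+1)*B)^2*((M+1)*C))"
            "c (Suc n) j = (2*J+M+2)*(2*J+M+1)*A / (B^2*((M+2)*(M+1)*C))"
            "c n (Suc j) = (2*J+M+2)*(2*J+M+1)*A / (((J+1)*B)^2*C)"
      unfolding c_def n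
      by (simp_all add: Suc_diff_le f2 C_def [symmetric] B_def [symmetric] J_def M_def algebra_simps)
    have r: "real (n + 2) = J + M + 3" "real (2 * n + 3) = 2 * J + 2 * M + 5" "real (n + 1) = J + M + 2"
      by (simp_all add: n J_def M_def)
    have nz': "J + 1 \<noteq> 0" "M + 1 \<noteq> 0" "M + 2 \<noteq> 0" using pos by auto
    define K where "K = (2*J+M+2)*(2*J+M+1)*A / ((J+1)^2*B^2*((M+2)*(M+1)*C))"
    have e': "c (Suc (Suc n)) (Suc j) = (2*J+M+4)*(2*J+M+3)*K"
            "c (Suc n) (Suc j) = (2*J+M+3)*(M+2)*K"
            "c (Suc n) j = (J+1)^2*K"
            "c n (Suc j) = (M+2)*(M+1)*K"
      unfolding e K_def using nz nz' by (simp_all add: divide_simps power_mult_distrib)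
    show ?thesis unfolding e' r by algebra
  next
    case 2
    have "(fact (Suc (Suc (Suc (n + n)))) :: real) = (2*n+3)*(2*n+2)*(2*n+1)*fact (n+n)" 
         "(fact (Suc (Suc (n + n))) :: real) = (2*n+2)*(2*n+1)*fact (n+n)"
         "(fact (Suc (n + n)) :: real) = (2*n+1)*fact (n+n)"
      by (simp_all add: algebra_simps)
    then show ?thesis using 2 
      by (simp add: c_def Suc_diff_le divide_simps del: fact_Suc)
         (simp add: algebra_simps power2_eq_square)
  next
    case 3
    have "(fact (Suc (Suc (Suc (Suc (n + n))))) :: real) = (2*n+4)*(2*n+3)*fact (Suc (Suc (n+n)))"
         "(fact (Suc (Suc n)) :: real) = (n+2)*fact (Suc n)"
      by (simp_all add: algebra_simps)
    moreover have "real n * fact (Suc n) + fact (Suc n) * 2 \<noteq> (0::real)"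
    proof -
      have "(real n + 2) * fact (Suc n) \<noteq> 0" by (simp del: fact_Suc)
      then show ?thesis by (simp add: algebra_simps del: fact_Suc)
    qed
    ultimately show ?thesis using 3
      by (simp add: c_def divide_simps del: fact_Suc)
         (simp add: algebra_simps power2_eq_square del: fact_Suc)
  next
    case 4
    then show ?thesis by (simp add: c_def)
  qed
qed

lemma legendre_P_Suc_Suc:
  "legendre_P (Suc (Suc n)) x =
     (real (2 * n + 3) * x * legendre_P (Suc n) x - real (n + 1) * legendre_P n x) / real (n + 2)"
proof -
  define t where "t = (x - 1) / 2"
  have x: "x = 1 + 2 * t" by (simp add: t_def field_simps)
  note S = legendre_P_sum [of _ "Suc (Suc n)" x, folded t_def]
  have shift: "(\<Sum>k\<le>Suc (Suc n). f k) = f 0 + (\<Sum>k\<le>Suc n. f (Suc k))" for f :: "nat \<Rightarrow> real"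
    by (rule sum.atMost_Suc_shift)
  have P1: "legendre_P (Suc n) x = (\<Sum>j\<le>Suc n. c (Suc n) j * t ^ j)"
    using legendre_P_sum [of "Suc n" "Suc n" x] by (simp add: t_def)
  have "real (n + 2) * legendre_P (Suc (Suc n)) x
      = real (n + 2) * c (Suc (Suc n)) 0 + (\<Sum>j\<le>Suc n. real (n + 2) * c (Suc (Suc n)) (Suc j) * t ^ Suc j)"
    by (simp add: S shift distrib_left sum_distrib_left mult.assoc del: sum.atMost_Suc)
  also have "\<dots> = real (2 * n + 3) * (c (Suc n) 0 + (\<Sum>j\<le>Suc n. c (Suc n) (Suc j) * t ^ Suc j))
        + real (2 * n + 3) * (2 * t * (\<Sum>j\<le>Suc n. c (Suc n) j * t ^ j))
        - real (n + 1) * (c n 0 + (\<Sum>j\<le>Suc n. c n (Suc j) * t ^ Suc j))"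
    unfolding c_rec_0 c_rec_Suc
    by (simp add: algebra_simps sum.distrib sum_subtractf sum_distrib_left del: sum.atMost_Suc)
  also have "\<dots> = real (2 * n + 3) * legendre_P (Suc n) x + real (2 * n + 3) * (2 * t * legendre_P (Suc n) x)
        - real (n + 1) * legendre_P n x"
    using S [of "Suc n"] S [of n] by (simp add: shift P1 [symmetric] del: sum.atMost_Suc)
  also have "\<dots> = real (2 * n + 3) * x * legendre_P (Suc n) x - real (n + 1) * legendre_P n x"
    unfolding x by (simp add: algebra_simps)
  finally show ?thesis by (simp add: field_simps)
qed

end

text \<open>Every solution of the recurrence with the right behaviour for \<open>n = 0, 1\<close> obeys the ladder
  relation below, and hence Legendre's equation.\<close>

lemma recurrence_ladder:
  fixes F F' :: "nat \<Rightarrow> real" and x :: real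
  assumes F: "\<And>n. real (n + 2) * F (Suc (Suc n)) = real (2 * n + 3) * x * F (Suc n) - real (n + 1) * F n"
    and F': "\<And>n. real (n + 2) * F' (Suc (Suc n)) =
               real (2 * n + 3) * (F (Suc n) + x * F' (Suc n)) - real (n + 1) * F' n"
    and zero: "(1 - x\<^sup>2) * F' 0 = x * F 0 - F (Suc 0)"
    and one: "(1 - x\<^sup>2) * F' (Suc 0) = F 0 - x * F (Suc 0)"
  shows "(1 - x\<^sup>2) * F' n = real (n + 1) * (x * F n - F (Suc n))"
    and "(1 - x\<^sup>2) * F' (Suc n) = real (n + 1) * (F n - x * F (Suc n))"
proof -
  have "(1 - x\<^sup>2) * F' n = real (n + 1) * (x * F n - F (Suc n)) \<and>
        (1 - x\<^sup>2) * F' (Suc n) = real (n + 1) * (F n - x * F (Suc n))"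
  proof (induction n)
    case 0
    then show ?case using zero one by simp
  next
    case (Suc n)
    define N where "N = real n"
    have R: "(N + 2) * F (Suc (Suc n)) = (2 * N + 3) * x * F (Suc n) - (N + 1) * F n"
      using F [of n] by (simp add: N_def algebra_simps)
    have R': "(N + 2) * F' (Suc (Suc n)) = (2 * N + 3) * (F (Suc n) + x * F' (Suc n)) - (N + 1) * F' n"
      using F' [of n] by (simp add: N_def algebra_simps)
    have I: "(1 - x\<^sup>2) * F' n = (N + 1) * (x * F n - F (Suc n))"
      "(1 - x\<^sup>2) * F' (Suc n) = (N + 1) * (F n - x * F (Suc n))"
      using Suc by (simp_all add: N_def algebra_simps)
    have a: "(1 - x\<^sup>2) * F' (Suc n) = (N + 2) * (x * F (Suc n) - F (Suc (Suc n)))"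
      using I R by algebra
    have "(N + 2) * ((1 - x\<^sup>2) * F' (Suc (Suc n))) = (N + 2) * ((N + 2) * (F (Suc n) - x * F (Suc (Suc n))))"
      using I R R' by algebra
    moreover have "N + 2 \<noteq> 0" unfolding N_def by linarith
    ultimately have "(1 - x\<^sup>2) * F' (Suc (Suc n)) = (N + 2) * (F (Suc n) - x * F (Suc (Suc n)))"
      by simp
    then show ?case using a by (simp add: N_def algebra_simps)
  qed
  then show "(1 - x\<^sup>2) * F' n = real (n + 1) * (x * F n - F (Suc n))"
    and "(1 - x\<^sup>2) * F' (Suc n) = real (n + 1) * (F n - x * F (Suc n))" by blast+
qed

lemma recurrence_ODE:
  fixes F F' :: "nat \<Rightarrow> real \<Rightarrow> real"
  assumes D: "\<And>n y. \<bar>y\<bar> < 1 \<Longrightarrow> (F n has_real_derivative F' n y) (at y)"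
    and L: "\<And>n y. \<bar>y\<bar> < 1 \<Longrightarrow> (1 - y\<^sup>2) * F' n y = real (n + 1) * (y * F n y - F (Suc n) y)"
    and L': "\<And>n y. \<bar>y\<bar> < 1 \<Longrightarrow> (1 - y\<^sup>2) * F' (Suc n) y = real (n + 1) * (F n y - y * F (Suc n) y)"
    and x: "\<bar>x\<bar> < 1"
  shows "((\<lambda>y. (1 - y\<^sup>2) * deriv (F n) y) has_real_derivative - (real n * real (n + 1)) * F n x) (at x)"
proof -
  have "((\<lambda>y. real (n + 1) * (y * F n y - F (Suc n) y)) has_real_derivative
          real (n + 1) * (F n x + x * F' n x - F' (Suc n) x)) (at x)"
    by (rule derivative_eq_intros D x refl | simp)+
  moreover have "real (n + 1) * (F n x + x * F' n x - F' (Suc n) x) = - (real n * real (n + 1)) * F n x"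
  proof -
    have nz: "1 - x\<^sup>2 \<noteq> 0" using x by (simp add: abs_square_eq_1)
    define N where "N = real (n + 1)"
    have "(1 - x\<^sup>2) * (F n x + x * F' n x - F' (Suc n) x) = (1 - x\<^sup>2) * (F n x - N * F n x)"
      using L [OF x, of n, folded N_def] L' [OF x, of n, folded N_def] by algebra
    then have e: "F n x + x * F' n x - F' (Suc n) x = F n x - N * F n x"
      using nz by (metis mult_left_cancel)
    show ?thesis unfolding e by (simp add: N_def algebra_simps)
  qed
  moreover have "\<forall>\<^sub>F y in nhds x. (1 - y\<^sup>2) * deriv (F n) y = real (n + 1) * (y * F n y - F (Suc n) y)"
  proof -
    have "\<forall>\<^sub>F y in nhds x. \<bar>y\<bar> < 1"
      using x by (intro eventually_nhds_in_open [of "{y. \<bar>y\<bar> < 1}", simplified])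
        (auto intro!: open_Collect_less continuous_intros)
    then show ?thesis
      by eventually_elim (simp only: DERIV_imp_deriv [OF D] L)
  qed
  ultimately show ?thesis
    by (subst DERIV_cong_ev [OF refl _ refl]) auto
qed

text \<open>The derivatives of \<open>P\<^sub>n\<close> and \<open>Q\<^sub>n\<close>, obtained by differentiating the recurrence.\<close>

fun legendre_P' :: "nat \<Rightarrow> real \<Rightarrow> real" where
  "legendre_P' 0 x = 0"
| "legendre_P' (Suc 0) x = 1"
| "legendre_P' (Suc (Suc n)) x =
     (real (2 * n + 3) * (legendre_P (Suc n) x + x * legendre_P' (Suc n) x) - real (n + 1) * legendre_P' n x)
       / real (n + 2)"

fun legendre_Q' :: "nat \<Rightarrow> real \<Rightarrow> real" where
  "legendre_Q' 0 x = 1 / (1 - x\<^sup>2)"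
| "legendre_Q' (Suc 0) x = artanh x + x / (1 - x\<^sup>2)"
| "legendre_Q' (Suc (Suc n)) x =
     (real (2 * n + 3) * (legendre_Q (Suc n) x + x * legendre_Q' (Suc n) x) - real (n + 1) * legendre_Q' n x)
       / real (n + 2)"

lemma legendre_P_deriv: "(legendre_P n has_real_derivative legendre_P' n x) (at x)"
proof (induction n x rule: legendre_P'.induct)
  case (3 n x)
  show ?case
    unfolding legendre_P_Suc_Suc [abs_def] legendre_P'.simps
    by (rule DERIV_cdivide) (rule derivative_eq_intros 3 refl | simp add: algebra_simps)+
qed (simp_all add: legendre_P_0 [abs_def] legendre_P_1 [abs_def])

lemma legendre_Q_deriv:
  "\<bar>x\<bar> < 1 \<Longrightarrow> (legendre_Q n has_real_derivative legendre_Q' n x) (at x)"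
proof (induction n x rule: legendre_Q'.induct)
  case (1 x)
  then show ?case
    by (auto simp: legendre_Q.simps [abs_def] intro!: derivative_eq_intros)
next
  case (2 x)
  then show ?case
    by (auto simp: legendre_Q.simps [abs_def] intro!: derivative_eq_intros)
next
  case (3 n x)
  show ?case
    unfolding legendre_Q.simps [abs_def] legendre_Q'.simps
    by (rule DERIV_cdivide) (rule derivative_eq_intros 3 refl | use 3 in \<open>simp add: algebra_simps\<close>)+
qed

lemma legendre_P_ladder:
  "(1 - x\<^sup>2) * legendre_P' n x = real (n + 1) * (x * legendre_P n x - legendre_P (Suc n) x)"
  "(1 - x\<^sup>2) * legendre_P' (Suc n) x = real (n + 1) * (legendre_P n x - x * legendre_P (Suc n) x)"
  by (rule recurrence_ladder [of "\<lambda>n. legendre_P n x" x "\<lambda>n. legendre_P' n x"];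
      simp add: legendre_P_0 legendre_P_1 legendre_P_Suc_Suc power2_eq_square del: of_nat_add)+

lemma legendre_Q_ladder:
  assumes "\<bar>x\<bar> < 1"
  shows "(1 - x\<^sup>2) * legendre_Q' n x = real (n + 1) * (x * legendre_Q n x - legendre_Q (Suc n) x)"
    and "(1 - x\<^sup>2) * legendre_Q' (Suc n) x = real (n + 1) * (legendre_Q n x - x * legendre_Q (Suc n) x)"
proof -
  have nz: "1 - x\<^sup>2 \<noteq> 0" using assms by (simp add: abs_square_eq_1)
  have 1: "(1 - x\<^sup>2) * legendre_Q' (Suc 0) x = legendre_Q 0 x - x * legendre_Q (Suc 0) x"
    using nz by (simp add: distrib_left) (simp add: algebra_simps power2_eq_square)
  have 0: "(1 - x\<^sup>2) * legendre_Q' 0 x = x * legendre_Q 0 x - legendre_Q (Suc 0) x"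
    using nz by simp
  show "(1 - x\<^sup>2) * legendre_Q' n x = real (n + 1) * (x * legendre_Q n x - legendre_Q (Suc n) x)"
    and "(1 - x\<^sup>2) * legendre_Q' (Suc n) x = real (n + 1) * (legendre_Q n x - x * legendre_Q (Suc n) x)"
    by (rule recurrence_ladder [of "\<lambda>n. legendre_Q n x" x "\<lambda>n. legendre_Q' n x", OF _ _ 0 1];
      simp del: of_nat_add)+
qed

lemma legendre_P_ODE:
  assumes "\<bar>x\<bar> < 1"
  shows "((\<lambda>y. (1 - y\<^sup>2) * deriv (legendre_P n) y) has_real_derivative
           - (real n * real (n + 1)) * legendre_P n x) (at x)"
  using assms by (intro recurrence_ODE [where F' = legendre_P'] legendre_P_deriv legendre_P_ladder)

lemma legendre_Q_ODE:
  assumes "\<bar>x\<bar> < 1"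
  shows "((\<lambda>y. (1 - y\<^sup>2) * deriv (legendre_Q n) y) has_real_derivative
           - (real n * real (n + 1)) * legendre_Q n x) (at x)"
  using assms by (intro recurrence_ODE [where F' = legendre_Q'] legendre_Q_deriv legendre_Q_ladder)

lemma legendre_casoratian:
  "real (n + 1) * (legendre_P (Suc n) x * legendre_Q n x - legendre_Q (Suc n) x * legendre_P n x) = 1"
proof (induction n)
  case 0
  then show ?case by (simp add: legendre_P_0 legendre_P_1)
next
  case (Suc n)
  have "real (n + 2) * legendre_P (Suc (Suc n)) x =
          real (2 * n + 3) * x * legendre_P (Suc n) x - real (n + 1) * legendre_P n x"
    and "real (n + 2) * legendre_Q (Suc (Suc n)) x =
          real (2 * n + 3) * x * legendre_Q (Suc n) x - real (n + 1) * legendre_Q n x"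
    by (simp_all add: legendre_P_Suc_Suc del: of_nat_add)
  then have "real (n + 2) * (legendre_P (Suc (Suc n)) x * legendre_Q (Suc n) x
      - legendre_Q (Suc (Suc n)) x * legendre_P (Suc n) x) = 1"
    using Suc by algebra
  then show ?case by simp
qed

lemma legendre_wronskian:
  assumes "\<bar>x\<bar> < 1"
  shows "legendre_P n x * deriv (legendre_Q n) x - legendre_Q n x * deriv (legendre_P n) x = 1 / (1 - x\<^sup>2)"
proof -
  have nz: "1 - x\<^sup>2 \<noteq> 0" using assms by (simp add: abs_square_eq_1)
  have d: "deriv (legendre_P n) x = legendre_P' n x" "deriv (legendre_Q n) x = legendre_Q' n x"
    using legendre_P_deriv legendre_Q_deriv assms by (simp_all add: DERIV_imp_deriv)
  have "(1 - x\<^sup>2) * (legendre_P n x * legendre_Q' n x - legendre_Q n x * legendre_P' n x) = 1"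
    using legendre_casoratian [of n x] legendre_P_ladder(1) [of x n] legendre_Q_ladder(1) [OF assms, of n]
    by algebra
  then show ?thesis
    using nz unfolding d by (simp add: field_simps)
qed

end

theory Submission
  imports Defs
begin

text \<open>
  Along the line \<open>\<alpha> + \<beta> = 0\<close> the three-term recurrence of the Jacobi polynomials
  \<open>F\<^sub>n = P\<^sub>n\<^sup>(\<^sup>\<delta>\<^sup>,\<^sup>-\<^sup>\<delta>\<^sup>)\<close> takes the form
  \<open>(n + 1) (n + 2) F\<^sub>n\<^sub>+\<^sub>2 = (n + 1) (2 n + 3) x F\<^sub>n\<^sub>+\<^sub>1 - ((n + 1)\<^sup>2 - \<delta>\<^sup>2) F\<^sub>n\<close>,
  in which \<open>\<delta>\<close> enters only through its square. Differentiating at \<open>\<delta> = 0\<close> therefore produces no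
  inhomogeneous term: the derivatives \<open>\<partial>\<^sub>\<delta> F\<^sub>n\<close> obey the Legendre recurrence themselves. Since
  \<open>P\<^sub>n\<close> and \<open>Q\<^sub>n\<close> obey it too, so does \<open>artanh x \<cdot> P\<^sub>n - Q\<^sub>n\<close>. Both sequences start with
  \<open>0, 1\<close> (because \<open>F\<^sub>0 = 1\<close> and \<open>F\<^sub>1 = x + \<delta>\<close>), so they coincide; this is
  \<open>jacobi_antisymmetric_deriv\<close>.

  The normalising value at \<open>x = 1\<close> is \<open>(\<delta> + 1)\<^sub>d / d!\<close>, that is the product of the factors
  \<open>1 + \<delta> / j\<close> for \<open>1 \<le> j \<le> d\<close>. It equals \<open>1\<close> at \<open>\<delta> = 0\<close> and its logarithmic derivative there
  is \<open>H\<^sub>d\<close>, so the quotient rule gives \<open>v\<^sub>0 = (artanh x \<cdot> P\<^sub>d - Q\<^sub>d) - H\<^sub>d P\<^sub>d\<close>.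
\<close>

text \<open>
  The coefficients of \<open>P\<^sub>n\<^sup>(\<^sup>\<delta>\<^sup>,\<^sup>-\<^sup>\<delta>\<^sup>)\<close> in powers of \<open>(x - 1) / 2\<close>. They are continued by zero
  beyond the degree, so that polynomials of neighbouring degrees can be compared as sums over one
  index range.
\<close>

definition jacobi_coeff :: "real \<Rightarrow> nat \<Rightarrow> nat \<Rightarrow> real" where
  "jacobi_coeff \<delta> n k =
     (if k \<le> n then fact (n + k) / (fact n * fact k)
        * (pochhammer (\<delta> + real k + 1) (n - k) / fact (n - k)) else 0)"

lemma jacobi_P_antisymmetric_sum:
  assumes "n \<le> N"
  shows "jacobi_P \<delta> (-\<delta>) n x = (\<Sum>k\<le>N. jacobi_coeff \<delta> n k * ((x - 1) / 2) ^ k)"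
proof -
  have poch: "pochhammer (real n + 1) k = fact (n + k) / fact n" for k
    using pochhammer_product' [of "1::real" n k]
    by (simp add: pochhammer_fact [symmetric] field_simps)
  have "jacobi_P \<delta> (-\<delta>) n x = (\<Sum>k\<le>n. jacobi_coeff \<delta> n k * ((x - 1) / 2) ^ k)"
    unfolding jacobi_P_def by (intro sum.cong) (auto simp: jacobi_coeff_def poch)
  also have "\<dots> = (\<Sum>k\<le>N. jacobi_coeff \<delta> n k * ((x - 1) / 2) ^ k)"
    using assms by (intro sum.mono_neutral_left) (auto simp: jacobi_coeff_def)
  finally show ?thesis .
qed

lemma jacobi_coeff_rec_0:
  "real (n + 1) * real (n + 2) * jacobi_coeff \<delta> (Suc (Suc n)) 0 =
     real (n + 1) * real (2 * n + 3) * jacobi_coeff \<delta> (Suc n) 0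
       - (real (n + 1) ^ 2 - \<delta>\<^sup>2) * jacobi_coeff \<delta> n 0"
proof -
  define N where "N = real n"
  define K where "K = jacobi_coeff \<delta> n 0 / ((N + 1) * (N + 2))"
  have nz: "N + 1 \<noteq> 0" "N + 2 \<noteq> 0" by (simp_all add: N_def add_eq_0_iff)
  have c: "jacobi_coeff \<delta> (Suc n) 0 = jacobi_coeff \<delta> n 0 * (\<delta> + 1 + N) / (N + 1)"
    "jacobi_coeff \<delta> (Suc (Suc n)) 0
       = jacobi_coeff \<delta> n 0 * (\<delta> + 1 + N) * (\<delta> + 2 + N) / ((N + 1) * (N + 2))"
    by (simp_all add: N_def jacobi_coeff_def pochhammer_Suc add_ac mult_ac)
  have e: "jacobi_coeff \<delta> (Suc (Suc n)) 0 = (\<delta> + 1 + N) * (\<delta> + 2 + N) * K"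
    "jacobi_coeff \<delta> (Suc n) 0 = (\<delta> + 1 + N) * (N + 2) * K"
    "jacobi_coeff \<delta> n 0 = (N + 1) * (N + 2) * K"
    unfolding c K_def using nz by simp_all
  have r: "real (n + 1) = N + 1" "real (n + 2) = N + 2" "real (2 * n + 3) = 2 * N + 3"
    by (simp_all add: N_def)
  show ?thesis
    unfolding e r by algebra
qed

text \<open>
  The coefficients of \<open>x F\<^sub>n\<^sub>+\<^sub>1\<close> mix two neighbouring ones because \<open>x = 1 + 2 \<cdot> (x - 1) / 2\<close>. Below
  the top two degrees all four coefficients are explicit multiples of a common factor; in the top two
  degrees some of them vanish, and these are computed separately.
\<close>

lemma jacobi_coeff_rec_Suc:
  "real (n + 1) * real (n + 2) * jacobi_coeff \<delta> (Suc (Suc n)) (Suc j) =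
     real (n + 1) * real (2 * n + 3) * (jacobi_coeff \<delta> (Suc n) (Suc j) + 2 * jacobi_coeff \<delta> (Suc n) j)
       - (real (n + 1) ^ 2 - \<delta>\<^sup>2) * jacobi_coeff \<delta> n (Suc j)"
proof -
  consider "Suc j \<le> n" | "j = n" | "j = Suc n" | "j > Suc n" by linarith
  then show ?thesis
  proof cases
    case 1
    then obtain m where n: "n = Suc (j + m)"
      by (metis add_Suc le_iff_add)
    define J M where "J = real j" and "M = real m"
    define A B C D S where "A = (fact (2 * j + m) :: real)" and "B = (fact j :: real)"
      and "C = (fact m :: real)" and "D = (fact (j + m) :: real)" and "S = pochhammer (\<delta> + J + 2) m"
    have pos: "J \<ge> 0" "M \<ge> 0" by (simp_all add: J_def M_def)
    have nz: "A \<noteq> 0" "B \<noteq> 0" "C \<noteq> 0" "D \<noteq> 0" by (simp_all add: A_def B_def C_def D_def)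
    have nz': "J + 1 \<noteq> 0" "M + 1 \<noteq> 0" "M + 2 \<noteq> 0" "J + M + 1 \<noteq> 0" "J + M + 2 \<noteq> 0" "J + M + 3 \<noteq> 0"
      using pos by auto
    have f: "fact (j + (j + m)) = A" "fact (j + m + j) = A"
      unfolding A_def by (rule arg_cong [where f = fact], simp)+
    have p: "pochhammer (\<delta> + real (Suc j) + 1) m = S"
      "pochhammer (\<delta> + real (Suc j) + 1) (Suc m) = S * (\<delta> + J + M + 2)"
      "pochhammer (\<delta> + real (Suc j) + 1) (Suc (Suc m)) = S * (\<delta> + J + M + 2) * (\<delta> + J + M + 3)"
      "pochhammer (\<delta> + real j + 1) (Suc (Suc m)) = (\<delta> + J + 1) * (S * (\<delta> + J + M + 2))"
      unfolding pochhammer_rec [of "\<delta> + real j + 1" "Suc m"]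
      by (simp_all add: S_def J_def M_def pochhammer_Suc add_ac)
    have s: "n - Suc j = m" "Suc n - Suc j = Suc m" "Suc (Suc n) - Suc j = Suc (Suc m)"
      "Suc n - j = Suc (Suc m)"
      using n by auto
    have g: "(fact n :: real) = (J + M + 1) * D"
      "(fact (Suc n) :: real) = (J + M + 2) * (J + M + 1) * D"
      "(fact (Suc (Suc n)) :: real) = (J + M + 3) * (J + M + 2) * (J + M + 1) * D"
      "(fact (n + Suc j) :: real) = (2*J+M+2) * (2*J+M+1) * A"
      "(fact (Suc n + Suc j) :: real) = (2*J+M+3) * (2*J+M+2) * (2*J+M+1) * A"
      "(fact (Suc n + j) :: real) = (2*J+M+2) * (2*J+M+1) * A"
      "(fact (Suc (Suc n) + Suc j) :: real) = (2*J+M+4) * (2*J+M+3) * (2*J+M+2) * (2*J+M+1) * A"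
      "(fact (Suc j) :: real) = (J + 1) * B" "(fact j :: real) = B" "(fact m :: real) = C"
      "(fact (Suc m) :: real) = (M + 1) * C" "(fact (Suc (Suc m)) :: real) = (M + 2) * (M + 1) * C"
      by (simp_all add: n f D_def B_def C_def J_def M_def algebra_simps)
    have le: "Suc j \<le> n" "Suc j \<le> Suc n" "Suc j \<le> Suc (Suc n)" "j \<le> Suc n"
      using n by auto
    \<comment> \<open>Common factor: the numerator of the lowest coefficient over the denominator of the highest one.\<close>
    define K where "K = (2*J+M+2) * (2*J+M+1) * A * S
      / ((J+M+3) * (J+M+2) * (J+M+1) * D * ((J+1) * B) * ((M+2) * (M+1) * C))"
    have cancel: "X / Y * (Z / W) = P * (Q / R)"
      if "X * Z * R = P * Q * (Y * W)" "Y \<noteq> 0" "W \<noteq> 0" "R \<noteq> 0" for X Y Z W P Q R :: real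
      using that by (simp add: frac_eq_eq)
    have e: "jacobi_coeff \<delta> (Suc (Suc n)) (Suc j)
        = (2*J+M+4) * (2*J+M+3) * (\<delta>+J+M+2) * (\<delta>+J+M+3) * K"
      "jacobi_coeff \<delta> (Suc n) (Suc j) = (J+M+3) * (2*J+M+3) * (\<delta>+J+M+2) * (M+2) * K"
      "jacobi_coeff \<delta> (Suc n) j = (J+M+3) * (J+1) * (\<delta>+J+1) * (\<delta>+J+M+2) * K"
      "jacobi_coeff \<delta> n (Suc j) = (J+M+3) * (J+M+2) * (M+2) * (M+1) * K"
      unfolding jacobi_coeff_def s p g K_def if_P [OF le(1)] if_P [OF le(2)] if_P [OF le(3)] if_P [OF le(4)]
      by (rule cancel; (simp only: mult_ac; fail)?; (simp add: nz nz')?)+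
    have r: "real (n + 2) = J + M + 3" "real (2 * n + 3) = 2 * J + 2 * M + 5" "real (n + 1) = J + M + 2"
      by (simp_all add: n J_def M_def)
    show ?thesis unfolding e r by algebra
  next
    case 2
    define N A B where "N = real n" and "A = (fact (n + n) :: real)" and "B = (fact n :: real)"
    have nz: "N + 1 \<noteq> 0" "N + 2 \<noteq> 0" "B \<noteq> 0" by (simp_all add: N_def B_def add_eq_0_iff)
    have g: "(fact (Suc (Suc n) + Suc n) :: real) = (2*N+3) * (2*N+2) * (2*N+1) * A"
      "(fact (Suc n + Suc n) :: real) = (2*N+2) * (2*N+1) * A"
      "(fact (Suc n + n) :: real) = (2*N+1) * A"
      "(fact (Suc (Suc n)) :: real) = (N+2) * (N+1) * B" "(fact (Suc n) :: real) = (N+1) * B"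
      "(fact n :: real) = B"
      by (simp_all add: N_def A_def B_def algebra_simps)
    have c: "jacobi_coeff \<delta> (Suc (Suc n)) (Suc n)
        = (2*N+3) * (2*N+2) * (2*N+1) * A / ((N+2) * (N+1) * B * ((N+1) * B)) * (\<delta> + N + 2)"
      "jacobi_coeff \<delta> (Suc n) (Suc n) = (2*N+2) * (2*N+1) * A / ((N+1) * B * ((N+1) * B))"
      "jacobi_coeff \<delta> (Suc n) n = (2*N+1) * A / ((N+1) * B * B) * (\<delta> + N + 1)"
      unfolding jacobi_coeff_def g by (simp_all add: Suc_diff_le N_def add_ac)
    define K where "K = (2*N+1) * A / ((N+2) * ((N+1) * B) * ((N+1) * B))"
    have e: "jacobi_coeff \<delta> (Suc (Suc n)) (Suc n) = (2*N+3) * (2*N+2) * (\<delta>+N+2) * K"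
      "jacobi_coeff \<delta> (Suc n) (Suc n) = (2*N+2) * (N+2) * K"
      "jacobi_coeff \<delta> (Suc n) n = (N+1) * (N+2) * (\<delta>+N+1) * K"
      unfolding c K_def
      by (simp only: times_divide_eq_right times_divide_eq_left divide_divide_eq_left, subst frac_eq_eq,
        use nz in \<open>simp only: mult_eq_0_iff; simp\<close>, use nz in \<open>simp only: mult_eq_0_iff; simp\<close>,
        simp only: mult_ac)+
    have z: "jacobi_coeff \<delta> n (Suc n) = 0"
      by (simp add: jacobi_coeff_def)
    have r: "real (n + 1) = N + 1" "real (n + 2) = N + 2" "real (2 * n + 3) = 2 * N + 3"
      by (simp_all add: N_def)
    show ?thesis unfolding 2 e z r by algebra
  next
    case 3
    define N A B where "N = real n" and "A = (fact (Suc n + Suc n) :: real)" and "B = (fact (Suc n) :: real)"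
    have nz: "N + 1 \<noteq> 0" "N + 2 \<noteq> 0" "B \<noteq> 0" by (simp_all add: N_def B_def add_eq_0_iff del: fact_Suc)
    have g: "(fact (Suc (Suc n) + Suc (Suc n)) :: real) = (2*N+4) * (2*N+3) * A"
      "(fact (Suc (Suc n)) :: real) = (N+2) * B"
      by (simp_all add: N_def A_def B_def algebra_simps)
    have c: "jacobi_coeff \<delta> (Suc (Suc n)) (Suc (Suc n)) = (2*N+4) * (2*N+3) * A / ((N+2) * B * ((N+2) * B))"
      "jacobi_coeff \<delta> (Suc n) (Suc n) = A / (B * B)"
      unfolding jacobi_coeff_def g A_def [symmetric] B_def [symmetric] by simp_all
    define K where "K = A / ((N+2) * B * ((N+2) * B))"
    have e: "jacobi_coeff \<delta> (Suc (Suc n)) (Suc (Suc n)) = (2*N+4) * (2*N+3) * K"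
      "jacobi_coeff \<delta> (Suc n) (Suc n) = (N+2) * (N+2) * K"
      unfolding c K_def
      using nz by simp_all
    have z: "jacobi_coeff \<delta> (Suc n) (Suc (Suc n)) = 0" "jacobi_coeff \<delta> n (Suc (Suc n)) = 0"
      by (simp_all add: jacobi_coeff_def)
    have r: "real (n + 1) = N + 1" "real (n + 2) = N + 2" "real (2 * n + 3) = 2 * N + 3"
      by (simp_all add: N_def)
    show ?thesis unfolding 3 e z r by algebra
  next
    case 4
    then show ?thesis by (simp add: jacobi_coeff_def)
  qed
qed

lemma jacobi_P_antisymmetric_Suc_Suc:
  "jacobi_P \<delta> (-\<delta>) (Suc (Suc n)) x =
     (real (n + 1) * real (2 * n + 3) * x * jacobi_P \<delta> (-\<delta>) (Suc n) x
       - (real (n + 1) ^ 2 - \<delta>\<^sup>2) * jacobi_P \<delta> (-\<delta>) n x) / (real (n + 1) * real (n + 2))"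
proof -
  define t where "t = (x - 1) / 2"
  have x: "x = 1 + 2 * t" by (simp add: t_def field_simps)
  define P where "P m = jacobi_P \<delta> (-\<delta>) m x" for m
  define a where "a = jacobi_coeff \<delta>"
  define u v w where "u = real (n + 1) * real (n + 2)" and "v = real (n + 1) * real (2 * n + 3)"
    and "w = real (n + 1) ^ 2 - \<delta>\<^sup>2"
  have S: "P m = a m 0 + (\<Sum>j\<le>Suc n. a m (Suc j) * t ^ Suc j)" if "m \<le> Suc (Suc n)" for m
    unfolding P_def jacobi_P_antisymmetric_sum [OF that] a_def t_def
    by (subst sum.atMost_Suc_shift) simp
  have P1: "P (Suc n) = (\<Sum>j\<le>Suc n. a (Suc n) j * t ^ j)"
    unfolding P_def a_def t_def by (rule jacobi_P_antisymmetric_sum) simp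
  have rec0: "u * a (Suc (Suc n)) 0 = v * a (Suc n) 0 - w * a n 0"
    unfolding u_def v_def w_def a_def by (rule jacobi_coeff_rec_0)
  have rec: "u * a (Suc (Suc n)) (Suc j) = v * (a (Suc n) (Suc j) + 2 * a (Suc n) j) - w * a n (Suc j)" for j
    unfolding u_def v_def w_def a_def by (rule jacobi_coeff_rec_Suc)
  have "u * P (Suc (Suc n))
      = u * a (Suc (Suc n)) 0 + (\<Sum>j\<le>Suc n. u * a (Suc (Suc n)) (Suc j) * t ^ Suc j)"
    by (simp add: S distrib_left sum_distrib_left mult.assoc del: sum.atMost_Suc)
  also have "\<dots> = v * (a (Suc n) 0 + (\<Sum>j\<le>Suc n. a (Suc n) (Suc j) * t ^ Suc j))
        + v * (2 * t * (\<Sum>j\<le>Suc n. a (Suc n) j * t ^ j))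
        - w * (a n 0 + (\<Sum>j\<le>Suc n. a n (Suc j) * t ^ Suc j))"
    unfolding rec0 rec
    by (simp add: algebra_simps sum.distrib sum_subtractf sum_distrib_left del: sum.atMost_Suc)
  also have "\<dots> = v * P (Suc n) + v * (2 * t * P (Suc n)) - w * P n"
    using S [of "Suc n"] S [of n] by (simp add: P1 [symmetric] del: sum.atMost_Suc)
  also have "\<dots> = v * x * P (Suc n) - w * P n"
    unfolding x by (simp add: algebra_simps)
  finally have "u * P (Suc (Suc n)) = v * x * P (Suc n) - w * P n" .
  moreover have "u \<noteq> 0"
    unfolding u_def by (simp del: of_nat_add)
  ultimately show ?thesis
    unfolding P_def u_def [symmetric] v_def [symmetric] w_def [symmetric] by (simp add: field_simps)
qed

text \<open>
  The derivative of \<open>\<delta>\<^sup>2\<close> vanishes at \<open>\<delta> = 0\<close>, so both sides obey the Legendre recurrence and it is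
  enough to compare them for \<open>n = 0\<close> and \<open>n = 1\<close>. The logarithm in \<open>Q\<^sub>n\<close> cancels; the right-hand
  side is the polynomial of degree \<open>n - 1\<close> usually written \<open>W\<^sub>n\<^sub>-\<^sub>1\<close>.
\<close>

lemma jacobi_antisymmetric_deriv:
  "((\<lambda>\<delta>. jacobi_P \<delta> (-\<delta>) n x) has_real_derivative
      artanh x * legendre_P n x - legendre_Q n x) (at 0)"
proof (induction n rule: induct_nat_012)
  case 0
  then show ?case by (simp add: jacobi_P_def legendre_P_0)
next
  case 1
  have "(\<lambda>\<delta>. jacobi_P \<delta> (-\<delta>) (Suc 0) x) = (\<lambda>\<delta>. \<delta> + x)"
    by (simp add: jacobi_P_def field_simps)
  then show ?case
    by (auto simp: legendre_P_1 algebra_simps intro!: derivative_eq_intros)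
next
  case (ge2 n)
  define F where "F m \<delta> = jacobi_P \<delta> (-\<delta>) m x" for m \<delta>
  define D where "D m = artanh x * legendre_P m x - legendre_Q m x" for m
  define q r s where "q = real (n + 1)" and "r = real (n + 2)" and "s = real (2 * n + 3)"
  have q: "q \<noteq> 0" by (simp add: q_def del: of_nat_add)
  have IH: "(F n has_real_derivative D n) (at 0)" "(F (Suc n) has_real_derivative D (Suc n)) (at 0)"
    using ge2 by (simp_all add: F_def [abs_def] D_def)
  have F: "F (Suc (Suc n)) = (\<lambda>\<delta>. (q * s * x * F (Suc n) \<delta> - (q\<^sup>2 - \<delta>\<^sup>2) * F n \<delta>) / (q * r))"
    unfolding F_def q_def r_def s_def jacobi_P_antisymmetric_Suc_Suc ..
  have "((\<lambda>\<delta>. q * s * x * F (Suc n) \<delta> - (q\<^sup>2 - \<delta>\<^sup>2) * F n \<delta>) has_real_derivative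
      q * s * x * D (Suc n) - q\<^sup>2 * D n) (at 0)"
    \<comment> \<open>The term \<open>2 \<delta> \<cdot> F n \<delta>\<close> of the product rule vanishes at the point \<open>0\<close>.\<close>
    by (rule derivative_eq_intros IH refl | simp)+
  then have "(F (Suc (Suc n)) has_real_derivative (q * s * x * D (Suc n) - q\<^sup>2 * D n) / (q * r)) (at 0)"
    unfolding F by (rule DERIV_cdivide)
  moreover have "q * s * x * D (Suc n) - q\<^sup>2 * D n = q * (s * x * D (Suc n) - q * D n)"
    by (simp add: power2_eq_square right_diff_distrib mult.assoc)
  moreover have "D (Suc (Suc n)) = (s * x * D (Suc n) - q * D n) / r"
    unfolding D_def legendre_P_Suc_Suc legendre_Q.simps q_def [symmetric] r_def [symmetric] s_def [symmetric]
      times_divide_eq_right diff_divide_distrib [symmetric]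
    by (rule arg_cong [where f = "\<lambda>y. y / r"]) algebra
  ultimately show ?case
    using q by (simp add: F_def [abs_def] D_def)
qed

lemma jacobi_antisymmetric_at_1_deriv:
  "((\<lambda>\<delta>. jacobi_P \<delta> (-\<delta>) n 1) has_real_derivative harm n) (at 0)"
proof -
  have "((\<lambda>\<delta>::real. pochhammer (\<delta> + 1) n / fact n) has_real_derivative harm n) (at 0)"
  proof (induction n)
    case 0
    then show ?case by (simp add: harm_def)
  next
    case (Suc n)
    have "(\<lambda>\<delta>::real. pochhammer (\<delta> + 1) (Suc n) / fact (Suc n))
        = (\<lambda>\<delta>. pochhammer (\<delta> + 1) n / fact n * (1 + \<delta> / real (Suc n)))"
      by (simp add: pochhammer_Suc field_simps)
    moreover have "((\<lambda>\<delta>::real. pochhammer (\<delta> + 1) n / fact n * (1 + \<delta> / real (Suc n)))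
        has_real_derivative harm (Suc n)) (at 0)"
      by (rule derivative_eq_intros Suc refl | simp del: of_nat_Suc)+
        (simp add: harm_Suc pochhammer_fact [symmetric] inverse_eq_divide)
    ultimately show ?case by simp
  qed
  moreover have "(\<lambda>\<delta>. jacobi_P \<delta> (-\<delta>) n 1) = (\<lambda>\<delta>. pochhammer (\<delta> + 1) n / fact n)"
    by (simp add: jacobi_P_at_1 gbinomial_pochhammer' add.commute)
  ultimately show ?thesis by simp
qed

lemma transverse_v0_eq:
  "transverse_v0 d x = artanh x * legendre_P d x - legendre_Q d x - harm d * legendre_P d x"
proof -
  have at_1: "jacobi_P 0 0 d 1 = 1"
    by (simp add: jacobi_P_at_1 gbinomial_pochhammer' pochhammer_fact [symmetric])
  have "((\<lambda>\<delta>. jacobi_P \<delta> (-\<delta>) d x / jacobi_P \<delta> (-\<delta>) d 1) has_real_derivative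
      artanh x * legendre_P d x - legendre_Q d x - harm d * legendre_P d x) (at 0)"
    using DERIV_divide [OF jacobi_antisymmetric_deriv [of d x] jacobi_antisymmetric_at_1_deriv [of d]]
    by (simp add: at_1 legendre_P_def mult.commute)
  then show ?thesis
    unfolding transverse_v0_def by (rule DERIV_imp_deriv)
qed

theorem proposition9p4:
  fixes d :: nat and x :: real
  assumes "-1 < x" and "x < 1" and "legendre_P d x \<noteq> 0"
  shows "transverse_v0 d x / legendre_P d x
           = artanh x - legendre_Q d x / legendre_P d x - harm d"
  using assms(3) by (simp add: transverse_v0_eq diff_divide_distrib)

end
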